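(* Let $G(p)$ be a continuous tensegrity in $\mathbb{R}^n$ with (compact) edgeset $\mathscr{E}$, rigidity operator $Y$ and space of design variations $\mathcal{X}$. If $G(p)$ has a strictly positive stress, then $G(p)$ is $\mathcal{X}$-bar equivalent.
   Context: A (continuous) tensegrity $G(p)$ in $\mathbb{R}^n$ consists of a (possibly infinite) set $\mathscr{V}$ of vertices, an injective map $p:\mathscr{V}\to\mathbb{R}^n$, and three pairwise disjoint sets $\mathsf{S}$ (struts), $\mathsf{C}$ (cables), $\mathsf{B}$ (bars) of two-element subsets of $\mathscr{V}$. The set $\mathscr{V}$ carries the metric $d_{\mathscr V}(v,w)=\|p(v)-p(w)\|$. Put $\mathscr{S}=\mathsf{S}\cup\mathsf{B}$ and $\mathscr{C}=\mathsf{C}\cup\mathsf{B}$ (functional struts and cables). The edgeset is the disjoint union $\mathscr{E}=\mathscr{S}\sqcup\mathscr{C}$ (so a bar occurs twice, once as a strut and once as a cable). Two edges of the same type have distance $\min\{\max(d_{\mathscr V}(v_1,v_3),d_{\mathscr V}(v_2,v_4)),\max(d_{\mathscr V}(v_1,v_4),d_{\mathscr V}(v_2,v_3))\}$ for edges $\{v_1,v_2\},\{v_3,v_4\}$; edges of different types have distance $\infty$. $\mathscr{E}$ has the metric topology and is required to be compact. $\mathrm{Vf}(\mathscr{V})$ is the space of continuous maps $V:\mathscr{V}\to\mathbb{R}^n$ (variations). $T(p)$ is the set of Euclidean motions, i.e. variations $v\mapsto Mp(v)+t$ with $M$ a skew-symmetric $n\times n$ matrix and $t\in\mathbb{R}^n$.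 The design variations form a linear subspace $\mathcal{X}\subset\mathrm{Vf}(\mathscr{V})$ with $T(p)\subset\mathcal{X}$. The rigidity operator $Y:\mathrm{Vf}(\mathscr{V})\to C(\mathscr{E})$ is $(YV)(\{v_1,v_2\})=\pm(V(v_1)-V(v_2))\cdot(p(v_1)-p(v_2))$, with sign $+$ on $\mathscr{S}$ and $-$ on $\mathscr{C}$. $C(\mathscr{E})$ is the space of continuous real functions on $\mathscr{E}$ with the sup norm, $C(\mathscr{E})^+$ the set of nonnegative ones, and $C^*(\mathscr{E})$ the topological dual of $C(\mathscr{E})$. A stress is a $\mu\in C^*(\mathscr{E})$ with $\mu(YV)=0$ for all $V\in\mathcal{X}$; a strictly positive stress is a stress $\mu$ with $\mu(f)>0$ for all nonzero $f\in C(\mathscr{E})^+$. $G(p)$ is $\mathcal{X}$-bar equivalent if every $V\in\mathcal{X}$ with $YV\in C(\mathscr{E})^+$ satisfies $YV=0$. *)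

theory Defs
  imports "HOL-Analysis.Analysis"
begin

record ('v, 'n::finite) tensegrity_data =
  verts :: "'v set"
  pos :: "'v \<Rightarrow> real ^ 'n"
  struts :: "'v set set"
  cables :: "'v set set"
  bars :: "'v set set"

(* The left summand holds the functional struts and the right summand the functional cables,
   so every bar contributes two edges. *)
definition edges :: "('v, 'n::finite) tensegrity_data \<Rightarrow> ('v set + 'v set) set" where
  "edges G = (struts G \<union> bars G) <+> (cables G \<union> bars G)"

definition vert_dist :: "('v, 'n::finite) tensegrity_data \<Rightarrow> 'v \<Rightarrow> 'v \<Rightarrow> real" where
  "vert_dist G v w = norm (pos G v - pos G w)"

abbreviation vert_topology :: "('v, 'n::finite) tensegrity_data \<Rightarrow> 'v topology" where
  "vert_topology G \<equiv> Metric_space.mtopology (verts G) (vert_dist G)"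

(* The descriptor only removes the choice of an order on the end points; see pair_dist_eq. *)
definition pair_dist :: "('v, 'n::finite) tensegrity_data \<Rightarrow> 'v set \<Rightarrow> 'v set \<Rightarrow> real" where
  "pair_dist G e e' = (THE r. \<exists>v1 v2 v3 v4. e = {v1, v2} \<and> e' = {v3, v4} \<and>
     r = min (max (vert_dist G v1 v3) (vert_dist G v2 v4))
             (max (vert_dist G v1 v4) (vert_dist G v2 v3)))"

fun edge_dist :: "('v, 'n::finite) tensegrity_data \<Rightarrow> 'v set + 'v set \<Rightarrow> 'v set + 'v set \<Rightarrow> ereal"
  where
    "edge_dist G (Inl e) (Inl e') = ereal (pair_dist G e e')"
  | "edge_dist G (Inr e) (Inr e') = ereal (pair_dist G e e')"
  | "edge_dist G (Inl e) (Inr e') = \<infinity>"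
  | "edge_dist G (Inr e) (Inl e') = \<infinity>"

(* The metric topology of an extended metric; Metric_space only allows real distances. *)
definition edge_topology :: "('v, 'n::finite) tensegrity_data \<Rightarrow> ('v set + 'v set) topology" where
  "edge_topology G = topology (\<lambda>U. U \<subseteq> edges G \<and>
     (\<forall>e\<in>U. \<exists>r>0. \<forall>e'\<in>edges G. edge_dist G e e' < ereal r \<longrightarrow> e' \<in> U))"

definition tensegrity :: "('v, 'n::finite) tensegrity_data \<Rightarrow> bool" where
  "tensegrity G \<longleftrightarrow>
     inj_on (pos G) (verts G) \<and>
     struts G \<subseteq> {e. e \<subseteq> verts G \<and> card e = 2} \<and>
     cables G \<subseteq> {e. e \<subseteq> verts G \<and> card e = 2} \<and>
     bars G \<subseteq> {e. e \<subseteq> verts G \<and> card e = 2} \<and>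
     struts G \<inter> cables G = {} \<and> struts G \<inter> bars G = {} \<and> cables G \<inter> bars G = {} \<and>
     compact_space (edge_topology G)"

(* Functions on a carrier are represented by their extensional representatives, as in
   the library's cfunspace. *)
definition variations :: "('v, 'n::finite) tensegrity_data \<Rightarrow> ('v \<Rightarrow> real ^ 'n) set" where
  "variations G = {V \<in> extensional (verts G). continuous_map (vert_topology G) euclidean V}"

definition euclidean_motions :: "('v, 'n::finite) tensegrity_data \<Rightarrow> ('v \<Rightarrow> real ^ 'n) set" where
  "euclidean_motions G = {\<lambda>v\<in>verts G. M *v pos G v + t | M t. transpose M = - M}"

definition design_space ::
    "('v, 'n::finite) tensegrity_data \<Rightarrow> ('v \<Rightarrow> real ^ 'n) set \<Rightarrow> bool" where
  "design_space G X \<longleftrightarrow>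
     X \<subseteq> variations G \<and>
     (\<lambda>v\<in>verts G. 0) \<in> X \<and>
     (\<forall>V\<in>X. \<forall>W\<in>X. (\<lambda>v\<in>verts G. V v + W v) \<in> X) \<and>
     (\<forall>c. \<forall>V\<in>X. (\<lambda>v\<in>verts G. c *\<^sub>R V v) \<in> X) \<and>
     euclidean_motions G \<subseteq> X"

(* As for pair_dist, the descriptor is resolved by symmetry; see pair_rate_eq. *)
definition pair_rate ::
    "('v, 'n::finite) tensegrity_data \<Rightarrow> ('v \<Rightarrow> real ^ 'n) \<Rightarrow> 'v set \<Rightarrow> real" where
  "pair_rate G V e = (THE r. \<exists>v1 v2. e = {v1, v2} \<and>
     r = (V v1 - V v2) \<bullet> (pos G v1 - pos G v2))"

definition rigidity_op ::
    "('v, 'n::finite) tensegrity_data \<Rightarrow> ('v \<Rightarrow> real ^ 'n) \<Rightarrow> 'v set + 'v set \<Rightarrow> real" where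
  "rigidity_op G V = (\<lambda>e\<in>edges G. case e of Inl s \<Rightarrow> pair_rate G V s | Inr c \<Rightarrow> - pair_rate G V c)"

(* The metric of cfunspace is the sup distance. *)
abbreviation edge_functions ::
    "('v, 'n::finite) tensegrity_data \<Rightarrow> ('v set + 'v set \<Rightarrow> real) metric" where
  "edge_functions G \<equiv> cfunspace (edge_topology G) euclidean_metric"

definition nonneg_edge_functions ::
    "('v, 'n::finite) tensegrity_data \<Rightarrow> ('v set + 'v set \<Rightarrow> real) set" where
  "nonneg_edge_functions G = {f \<in> mspace (edge_functions G). \<forall>e\<in>edges G. 0 \<le> f e}"

definition edge_dual ::
    "('v, 'n::finite) tensegrity_data \<Rightarrow> (('v set + 'v set \<Rightarrow> real) \<Rightarrow> real) set" where
  "edge_dual G = {\<mu> \<in> extensional (mspace (edge_functions G)).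
     (\<forall>f\<in>mspace (edge_functions G). \<forall>g\<in>mspace (edge_functions G).
        \<mu> (\<lambda>e\<in>edges G. f e + g e) = \<mu> f + \<mu> g) \<and>
     (\<forall>c. \<forall>f\<in>mspace (edge_functions G). \<mu> (\<lambda>e\<in>edges G. c * f e) = c * \<mu> f) \<and>
     continuous_map (mtopology_of (edge_functions G)) euclideanreal \<mu>}"

definition stress ::
    "('v, 'n::finite) tensegrity_data \<Rightarrow> ('v \<Rightarrow> real ^ 'n) set \<Rightarrow>
     (('v set + 'v set \<Rightarrow> real) \<Rightarrow> real) \<Rightarrow> bool" where
  "stress G X \<mu> \<longleftrightarrow> \<mu> \<in> edge_dual G \<and> (\<forall>V\<in>X. \<mu> (rigidity_op G V) = 0)"

definition strictly_positive_stress ::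
    "('v, 'n::finite) tensegrity_data \<Rightarrow> ('v \<Rightarrow> real ^ 'n) set \<Rightarrow>
     (('v set + 'v set \<Rightarrow> real) \<Rightarrow> real) \<Rightarrow> bool" where
  "strictly_positive_stress G X \<mu> \<longleftrightarrow> stress G X \<mu> \<and>
     (\<forall>f\<in>nonneg_edge_functions G. f \<noteq> (\<lambda>e\<in>edges G. 0) \<longrightarrow> \<mu> f > 0)"

definition bar_equivalent ::
    "('v, 'n::finite) tensegrity_data \<Rightarrow> ('v \<Rightarrow> real ^ 'n) set \<Rightarrow> bool" where
  "bar_equivalent G X \<longleftrightarrow>
     (\<forall>V\<in>X. rigidity_op G V \<in> nonneg_edge_functions G \<longrightarrow>
        rigidity_op G V = (\<lambda>e\<in>edges G. 0))"

lemma vert_dist_commute: "vert_dist G v w = vert_dist G w v"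
  by (simp add: vert_dist_def norm_minus_commute)

lemma pair_dist_eq:
  "pair_dist G {v1, v2} {v3, v4} =
     min (max (vert_dist G v1 v3) (vert_dist G v2 v4))
         (max (vert_dist G v1 v4) (vert_dist G v2 v3))"
  unfolding pair_dist_def
  by (rule the_equality) (auto simp: doubleton_eq_iff max.commute min.commute)

lemma pair_rate_eq:
  "pair_rate G V {v1, v2} = (V v1 - V v2) \<bullet> (pos G v1 - pos G v2)"
  unfolding pair_rate_def
  by (rule the_equality) (auto simp: doubleton_eq_iff inner_diff_left inner_diff_right)

lemma Metric_space_verts:
  assumes "inj_on (pos G) (verts G)"
  shows "Metric_space (verts G) (vert_dist G)"
proof
  show "vert_dist G x z \<le> vert_dist G x y + vert_dist G y z" for x y z
    unfolding vert_dist_def by (metis dist_norm dist_triangle)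
qed (use assms in \<open>auto simp: vert_dist_def norm_minus_commute inj_on_def\<close>)

lemma openin_edge_topology:
  "openin (edge_topology G) U \<longleftrightarrow> U \<subseteq> edges G \<and>
     (\<forall>e\<in>U. \<exists>r>0. \<forall>e'\<in>edges G. edge_dist G e e' < ereal r \<longrightarrow> e' \<in> U)"
proof -
  let ?P = "\<lambda>U. U \<subseteq> edges G \<and>
     (\<forall>e\<in>U. \<exists>r>0. \<forall>e'\<in>edges G. edge_dist G e e' < ereal r \<longrightarrow> e' \<in> U)"
  have "istopology ?P"
    unfolding istopology_def
  proof (intro conjI allI impI)
    fix S T assume S: "?P S" and T: "?P T"
    show "S \<inter> T \<subseteq> edges G" using S by blast
    show "\<forall>e\<in>S \<inter> T. \<exists>r>0. \<forall>e'\<in>edges G. edge_dist G e e' < ereal r \<longrightarrow> e' \<in> S \<inter> T"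
    proof
      fix e assume e: "e \<in> S \<inter> T"
      obtain r where r: "r > 0" "\<forall>e'\<in>edges G. edge_dist G e e' < ereal r \<longrightarrow> e' \<in> S"
        using S e by blast
      obtain s where s: "s > 0" "\<forall>e'\<in>edges G. edge_dist G e e' < ereal s \<longrightarrow> e' \<in> T"
        using T e by blast
      have "\<forall>e'\<in>edges G. edge_dist G e e' < ereal (min r s) \<longrightarrow> e' \<in> S \<inter> T"
        using r s by simp
      then show "\<exists>r>0. \<forall>e'\<in>edges G. edge_dist G e e' < ereal r \<longrightarrow> e' \<in> S \<inter> T"
        using r(1) s(1) by (intro exI[of _ "min r s"]) simp
    qed
  next
    fix K assume K: "\<forall>U\<in>K. ?P U"
    show "\<Union>K \<subseteq> edges G" using K by blast
    show "\<forall>e\<in>\<Union>K. \<exists>r>0. \<forall>e'\<in>edges G. edge_dist G e e' < ereal r \<longrightarrow> e' \<in> \<Union>K"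
      using K by (meson UnionE UnionI)
  qed
  then show ?thesis
    unfolding edge_topology_def by simp
qed

lemma topspace_edge_topology [simp]: "topspace (edge_topology G) = edges G"
proof -
  have "openin (edge_topology G) (edges G)"
    by (auto simp: openin_edge_topology intro: gt_ex)
  then show ?thesis
    by (metis openin_edge_topology openin_subset openin_topspace subset_antisym)
qed

lemma continuous_map_pair_rate:
  assumes G: "tensegrity G" and V: "V \<in> variations G"
  shows "continuous_map (prod_topology (vert_topology G) (vert_topology G)) euclideanreal
           (\<lambda>(v, w). (V v - V w) \<bullet> (pos G v - pos G w))"
proof -
  interpret M: Metric_space "verts G" "vert_dist G"
    using G by (simp add: tensegrity_def Metric_space_verts)
  have "continuous_map (vert_topology G) euclidean (pos G)"
    using M.metric_continuous_map[OF Met_TC.Metric_space_axioms, of "pos G"]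
    by (auto simp: vert_dist_def dist_norm)
  moreover have "continuous_map (vert_topology G) euclidean V"
    using V by (simp add: variations_def)
  moreover have diff: "continuous_map (prod_topology (vert_topology G) (vert_topology G)) euclidean
                   (\<lambda>z. f (fst z) - f (snd z))"
    if "continuous_map (vert_topology G) euclidean f" for f :: "'a \<Rightarrow> real ^ 'b"
    using that by (intro continuous_map_diff continuous_map_compose[OF continuous_map_fst, unfolded o_def]
          continuous_map_compose[OF continuous_map_snd, unfolded o_def])
  ultimately have pair: "continuous_map (prod_topology (vert_topology G) (vert_topology G))
      (prod_topology euclidean euclidean) (\<lambda>z. (V (fst z) - V (snd z), pos G (fst z) - pos G (snd z)))"
    by (intro continuous_map_pairedI diff)
  have inner: "continuous_map (prod_topology euclidean euclidean) euclideanreal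
      (\<lambda>z :: (real ^ 'b) \<times> (real ^ 'b). fst z \<bullet> snd z)"
    by (simp add: continuous_on_inner continuous_on_fst continuous_on_snd)
  show ?thesis
    using continuous_map_compose[OF pair inner] by (simp add: o_def case_prod_unfold)
qed

lemma pair_rate_nbhd:
  assumes G: "tensegrity G" and V: "V \<in> variations G"
    and s: "s \<subseteq> verts G" "card s = 2" and W: "open W" "pair_rate G V s \<in> W"
  shows "\<exists>r>0. \<forall>s'. s' \<subseteq> verts G \<longrightarrow> card s' = 2 \<longrightarrow> pair_dist G s s' < r \<longrightarrow> pair_rate G V s' \<in> W"
proof -
  interpret M: Metric_space "verts G" "vert_dist G"
    using G by (simp add: tensegrity_def Metric_space_verts)
  obtain v w where vw: "s = {v, w}" using s(2) by (auto simp: card_2_iff)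
  let ?h = "\<lambda>(v, w). (V v - V w) \<bullet> (pos G v - pos G w)"
  let ?T = "prod_topology (vert_topology G) (vert_topology G)"
  have "openin ?T {z \<in> topspace ?T. ?h z \<in> W}"
    using continuous_map_pair_rate[OF G V] W(1) by (intro openin_continuous_map_preimage) auto
  moreover have "(v, w) \<in> {z \<in> topspace ?T. ?h z \<in> W}"
    using s W vw by (auto simp: pair_rate_eq)
  ultimately obtain A B where AB: "openin (vert_topology G) A" "openin (vert_topology G) B"
      "v \<in> A" "w \<in> B" "A \<times> B \<subseteq> {z \<in> topspace ?T. ?h z \<in> W}"
    unfolding openin_prod_topology_alt by meson
  obtain a where a: "a > 0" "M.mball v a \<subseteq> A" using AB by (auto simp: M.openin_mtopology)
  obtain b where b: "b > 0" "M.mball w b \<subseteq> B" using AB by (auto simp: M.openin_mtopology)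
  have near: "?h (x, y) \<in> W" if "x \<in> verts G" "y \<in> verts G" "vert_dist G v x < min a b"
    "vert_dist G w y < min a b" for x y
  proof -
    have "x \<in> A" "y \<in> B" using that a b s vw by auto
    then show ?thesis using AB(5) by blast
  qed
  have "pair_rate G V s' \<in> W"
    if s': "s' \<subseteq> verts G" "card s' = 2" and d: "pair_dist G s s' < min a b" for s'
  proof -
    obtain x y where xy: "s' = {x, y}" using s'(2) by (auto simp: card_2_iff)
    then have "max (vert_dist G v x) (vert_dist G w y) < min a b \<or>
        max (vert_dist G v y) (vert_dist G w x) < min a b"
      using d vw by (simp only: pair_dist_eq min_less_iff_disj)
    then consider "vert_dist G v x < min a b" "vert_dist G w y < min a b"
      | "vert_dist G v y < min a b" "vert_dist G w x < min a b"
      by (meson max_less_iff_conj)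
    then show ?thesis
    proof cases
      case 1
      then show ?thesis using near[of x y] xy s' by (auto simp: pair_rate_eq)
    next
      case 2
      have "s' = {y, x}" using xy by blast
      then show ?thesis using 2 near[of y x] xy s' by (simp add: pair_rate_eq)
    qed
  qed
  then show ?thesis using a b by (intro exI[of _ "min a b"]) auto
qed

(* The rigidity operator takes values in C(E). *)
lemma rigidity_op_in_edge_functions:
  assumes G: "tensegrity G" and V: "V \<in> variations G"
  shows "rigidity_op G V \<in> mspace (edge_functions G)"
proof -
  let ?f = "rigidity_op G V"
  have two: "s \<subseteq> verts G" "card s = 2" if "Inl s \<in> edges G \<or> Inr s \<in> edges G" for s
    using that G by (auto simp: edges_def tensegrity_def)
  have "openin (edge_topology G) {e \<in> edges G. ?f e \<in> W}" if W: "open W" for W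
    unfolding openin_edge_topology
  proof (intro conjI ballI)
    fix e assume "e \<in> {e \<in> edges G. ?f e \<in> W}"
    then have e: "e \<in> edges G" "?f e \<in> W" by auto
    show "\<exists>r>0. \<forall>e'\<in>edges G. edge_dist G e e' < ereal r \<longrightarrow> e' \<in> {e \<in> edges G. ?f e \<in> W}"
    proof (cases e)
      case (Inl s)
      then have "pair_rate G V s \<in> W" using e by (simp add: rigidity_op_def)
      then obtain r where r: "r > 0" "\<And>s'. s' \<subseteq> verts G \<Longrightarrow> card s' = 2 \<Longrightarrow>
          pair_dist G s s' < r \<Longrightarrow> pair_rate G V s' \<in> W"
        using pair_rate_nbhd[OF G V _ _ W, of s] two[of s] e Inl by blast
      have "e' \<in> {e \<in> edges G. ?f e \<in> W}" if "e' \<in> edges G" "edge_dist G e e' < ereal r" for e'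
        using that Inl r(2) two by (cases e') (auto simp: rigidity_op_def)
      then show ?thesis using r(1) by blast
    next
      case (Inr s)
      have W': "open (uminus ` W)" using W by (rule open_negations)
      have "pair_rate G V s \<in> uminus ` W"
        using e Inr by (force simp: rigidity_op_def)
      then obtain r where r: "r > 0" "\<And>s'. s' \<subseteq> verts G \<Longrightarrow> card s' = 2 \<Longrightarrow>
          pair_dist G s s' < r \<Longrightarrow> pair_rate G V s' \<in> uminus ` W"
        using pair_rate_nbhd[OF G V _ _ W', of s] two[of s] e Inr by blast
      have "e' \<in> {e \<in> edges G. ?f e \<in> W}" if "e' \<in> edges G" "edge_dist G e e' < ereal r" for e'
      proof (cases e')
        case (Inl c)
        then show ?thesis using that Inr by simp
      next
        case (Inr c)
        then have "pair_rate G V c \<in> uminus ` W"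
          using that \<open>e = Inr s\<close> r(2)[of c] two[of c] by simp
        then show ?thesis using that Inr by (auto simp: rigidity_op_def)
      qed
      then show ?thesis using r(1) by blast
    qed
  qed auto
  then have cont: "continuous_map (edge_topology G) euclideanreal ?f"
    by (simp add: continuous_map_def)
  then have "compactin euclideanreal (?f ` edges G)"
    using G by (metis compact_space_def image_compactin tensegrity_def topspace_edge_topology)
  then have "bounded (?f ` edges G)" by (simp add: compact_imp_bounded)
  then show ?thesis using cont by (auto simp: rigidity_op_def)
qed

end

theory Submission
  imports Defs
begin

text \<open>A stress \<open>\<mu>\<close> sees every \<open>rigidity_op G V\<close> with
  \<open>V\<close> in \<open>X\<close> as 0, while strict positivity makes \<open>\<mu>\<close>
  positive on each nonzero nonnegative edge function. A nonnegative \<open>rigidity_op G V\<close>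
  therefore cannot be nonzero.\<close>

theorem theorem3p6p1:
  fixes G :: "('v, 'n::finite) tensegrity_data"
    and X :: "('v \<Rightarrow> real ^ 'n) set"
  assumes "tensegrity G"
    and "design_space G X"
    and "\<exists>\<mu>. strictly_positive_stress G X \<mu>"
  shows "bar_equivalent G X"
  using assms(3)
  unfolding bar_equivalent_def strictly_positive_stress_def stress_def
  \<comment> \<open>If \<open>rigidity_op G V\<close> were nonzero, its value under
    \<open>\<mu>\<close> would be both 0 and positive; \<open>less_irrefl\<close> refutes 0 <
    0.\<close>
  by (metis less_irrefl)

end
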